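(* Let $p$ be a prime, let $H\cong2\cdot\mathrm{S}_4$ be a subgroup of $\mathrm{SL}(2,p)$, and let $x\in\mathrm{SL}(2,p)$ satisfy $\langle H,x\rangle=\mathrm{SL}(2,p)$, $x^2\in H$ and $[H:L]=3$, where $L=x^{-1}Hx\cap H$. Let $S=H\cup xL$, and let $T=S\setminus\{z,z^{-1}\}$ for some $z\in S$. Then $\Delta(T)>\Delta(S)$.
   Context: For a subset $S$ of $\mathrm{SL}(2,p)$, $S^3=\{abc: a,b,c\in S\}$ and $\Delta(S)=\log(|S^3|)/\log(|S|)$. Here $2\cdot\mathrm{S}_4$ denotes the binary octahedral group of order 48, i.e. the double cover of $\mathrm{S}_4$ occurring as the full preimage in $\mathrm{SL}(2,p)$ of a subgroup $\mathrm{S}_4$ of $\mathrm{PSL}(2,p)$. Since $x^2\in H$, one has $xL=xH\cap Hx$. *)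

theory Defs
  imports "HOL-Analysis.Analysis" "HOL-Algebra.Generated_Groups" "HOL-Algebra.Coset"
    "Berlekamp_Zassenhaus.Finite_Field"
begin

text \<open>The field with $p$ elements is the type \<open>'p mod_ring\<close> for \<open>'p :: prime_card\<close>, so that
  $p$ is \<open>CARD('p)\<close>, and the universally quantified type variable ranges over all primes.\<close>

definition SL2 :: "(('p::prime_card) mod_ring ^ 2 ^ 2) monoid" where
  "SL2 = \<lparr>carrier = {A. det A = 1}, mult = (**), one = mat 1\<rparr>"

lemma group_SL2: "group (SL2 :: ('p::prime_card mod_ring ^ 2 ^ 2) monoid)"
proof (rule groupI)
  fix A :: "'p mod_ring ^ 2 ^ 2"
  assume A: "A \<in> carrier SL2"
  define B :: "'p mod_ring ^ 2 ^ 2"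
    where "B = vector [vector [A $ 2 $ 2, - (A $ 1 $ 2)], vector [- (A $ 2 $ 1), A $ 1 $ 1]]"
  have d: "A $ 1 $ 1 * A $ 2 $ 2 - A $ 1 $ 2 * A $ 2 $ 1 = 1"
    using A by (simp add: SL2_def det_2)
  have "det B = 1"
    using d by (simp add: B_def det_2 mult.commute)
  moreover have "B ** A = mat 1"
    using d by (simp add: B_def vec_eq_iff forall_2 matrix_matrix_mult_def sum_2 mat_def
        algebra_simps)
  ultimately show "\<exists>B\<in>carrier SL2. B \<otimes>\<^bsub>SL2\<^esub> A = \<one>\<^bsub>SL2\<^esub>"
    by (auto simp: SL2_def)
qed (auto simp: SL2_def det_mul matrix_mul_assoc)

text \<open>Quaternions over the reals, with $1, i, j, k$ as the basis.\<close>

datatype quat = Quat real real real real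

fun quat_mult :: "quat \<Rightarrow> quat \<Rightarrow> quat" where
  "quat_mult (Quat a b c d) (Quat a' b' c' d') =
     Quat (a * a' - b * b' - c * c' - d * d')
          (a * b' + b * a' + c * d' - d * c')
          (a * c' - b * d' + c * a' + d * b')
          (a * d' + b * c' - c * b' + d * a')"

text \<open>The binary octahedral group $2\cdot\mathrm{S}_4$ in its usual form: the quaternions
  $\pm1, \pm i, \pm j, \pm k$; the quaternions $(\pm1 \pm i \pm j \pm k)/2$; and the quaternions with
  two coordinates equal to $\pm1/\sqrt2$ and the other two equal to $0$ (8, 16 and 24 elements).\<close>

definition hurwitz_units :: "quat set" where
  "hurwitz_units =
     (\<Union>s\<in>{1, -1}. {Quat s 0 0 0, Quat 0 s 0 0, Quat 0 0 s 0, Quat 0 0 0 s}) \<union>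
     {Quat a b c d | a b c d. {a, b, c, d} \<subseteq> {1/2, -1/2}}"

definition octahedral_units :: "quat set" where
  "octahedral_units =
     (\<Union>s\<in>{1 / sqrt 2, -1 / sqrt 2}. \<Union>t\<in>{1 / sqrt 2, -1 / sqrt 2}.
        {Quat s t 0 0, Quat s 0 t 0, Quat s 0 0 t, Quat 0 s t 0, Quat 0 s 0 t, Quat 0 0 s t})"

definition binary_octahedral :: "quat monoid" where
  "binary_octahedral =
     \<lparr>carrier = hurwitz_units \<union> octahedral_units, mult = quat_mult, one = Quat 1 0 0 0\<rparr>"

definition tripling_exponent :: "('a, 'b) monoid_scheme \<Rightarrow> 'a set \<Rightarrow> real" where
  "tripling_exponent G S = ln (real (card (S <#>\<^bsub>G\<^esub> S <#>\<^bsub>G\<^esub> S))) / ln (real (card S))"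

end

theory Submission
  imports Defs
begin

text \<open>The set \<open>S\<close> is a union of left cosets of \<open>L\<close> as well as a union of right cosets of \<open>L\<close>: for
  \<open>H\<close> this is clear, and for \<open>xL\<close> it holds because \<open>x\<^sup>2 \<in> H\<close> makes \<open>x\<close> normalise \<open>L\<close>. Hence a
  product of three elements of \<open>S\<close> can be rewritten as
  \<open>a b c = (a u) (u\<inverse> b v) (v\<inverse> c)\<close> with \<open>u, v \<in> L\<close> arbitrary, all three factors staying in
  \<open>S\<close>. The group \<open>L\<close> has index 3 in a group of order 48, so there is ample room to choose \<open>u\<close> and \<open>v\<close>
  such that none of the three factors is one of the two removed elements. Therefore \<open>T\<^sup>3 = S\<^sup>3\<close>
  (\<open>set_mult_cube_Diff\<close>): removing the elements decreases the denominator of the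
  exponent and leaves the numerator unchanged (\<open>tripling_exponent_less\<close>).\<close>

section \<open>Triple products of unions of cosets\<close>

lemma (in group) card_translate_vimage_le:
  assumes "L \<subseteq> carrier G" "finite R" "a \<in> carrier G"
  shows "card {u \<in> L. a \<otimes> u \<in> R} \<le> card R"
proof (rule card_inj_on_le)
  show "inj_on (\<lambda>u. a \<otimes> u) {u \<in> L. a \<otimes> u \<in> R}"
    using assms by (intro inj_onI) (simp add: subset_iff)
qed (use assms in auto)

lemma (in group) card_inv_translate_vimage_le:
  assumes "L \<subseteq> carrier G" "finite R" "c \<in> carrier G"
  shows "card {v \<in> L. inv v \<otimes> c \<in> R} \<le> card R"
proof (rule card_inj_on_le)
  show "inj_on (\<lambda>v. inv v \<otimes> c) {v \<in> L. inv v \<otimes> c \<in> R}"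
  proof (rule inj_onI)
    fix v v' assume "v \<in> {v \<in> L. inv v \<otimes> c \<in> R}" "v' \<in> {v \<in> L. inv v \<otimes> c \<in> R}"
      and eq: "inv v \<otimes> c = inv v' \<otimes> c"
    then have G: "v \<in> carrier G" "v' \<in> carrier G"
      using assms by auto
    then have "inv v = inv v'"
      using eq assms(3) by simp
    then show "v = v'"
      using G by (metis inv_inv)
  qed
qed (use assms in auto)

text \<open>The factor 2 arises because \<open>u\<close> is chosen first, subject to one condition, namely
  \<open>a u \<notin> R\<close>, while \<open>v\<close> then has to satisfy two: \<open>u\<inverse> b v \<notin> R\<close> and \<open>v\<inverse> c \<notin> R\<close>. Each
  condition excludes at most \<open>card R\<close> elements of \<open>L\<close>.\<close>

lemma (in group) set_mult_cube_Diff: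
  assumes L: "subgroup L G"
    and S: "S \<subseteq> carrier G" "S <#> L \<subseteq> S" "L <#> S \<subseteq> S"
    and R: "finite R" "2 * card R < card L"
  shows "(S - R) <#> (S - R) <#> (S - R) = S <#> S <#> S"
proof
  show "(S - R) <#> (S - R) <#> (S - R) \<subseteq> S <#> S <#> S"
    by (intro mono_set_mult) auto
  have LG: "L \<subseteq> carrier G"
    using L by (rule subgroup.subset)
  have right: "s \<otimes> u \<in> S" and left: "u \<otimes> s \<in> S" if "s \<in> S" "u \<in> L" for s u
    using S(2,3) that unfolding set_mult_def by blast+
  show "S <#> S <#> S \<subseteq> (S - R) <#> (S - R) <#> (S - R)"
  proof
    fix w assume "w \<in> S <#> S <#> S"
    then obtain a b c where abc: "a \<in> S" "b \<in> S" "c \<in> S" and w: "w = a \<otimes> b \<otimes> c"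
      by (auto simp: set_mult_def)
    have carr: "a \<in> carrier G" "b \<in> carrier G" "c \<in> carrier G"
      using abc S by auto
    obtain u where u: "u \<in> L" "a \<otimes> u \<notin> R"
    proof (rule ccontr)
      assume "\<not> thesis"
      then have "{u \<in> L. a \<otimes> u \<in> R} = L"
        using that by blast
      then show False
        using card_translate_vimage_le[OF LG R(1) carr(1)] R(2) by simp
    qed
    have uG: "u \<in> carrier G" and u': "inv u \<in> L"
      using u LG subgroup.m_inv_closed[OF L] by auto
    define b' where "b' = inv u \<otimes> b"
    have b': "b' \<in> carrier G" "b' \<in> S"
      using uG carr left[OF abc(2) u'] by (auto simp: b'_def)
    obtain v where v: "v \<in> L" "b' \<otimes> v \<notin> R" "inv v \<otimes> c \<notin> R"
    proof (rule ccontr)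
      assume "\<not> thesis"
      then have "{v \<in> L. b' \<otimes> v \<in> R} \<union> {v \<in> L. inv v \<otimes> c \<in> R} = L"
        using that by blast
      then have "card L \<le> card {v \<in> L. b' \<otimes> v \<in> R} + card {v \<in> L. inv v \<otimes> c \<in> R}"
        by (metis card_Un_le)
      then show False
        using card_translate_vimage_le[OF LG R(1) b'(1)]
          card_inv_translate_vimage_le[OF LG R(1) carr(3)] R(2) by simp
    qed
    have vG: "v \<in> carrier G" and v': "inv v \<in> L"
      using v LG subgroup.m_inv_closed[OF L] by auto
    have "a \<otimes> u \<in> S - R" "b' \<otimes> v \<in> S - R" "inv v \<otimes> c \<in> S - R"
      using u v right[OF abc(1) u(1)] right[OF b'(2) v(1)] left[OF abc(3) v'] by auto
    moreover have "w = (a \<otimes> u) \<otimes> (b' \<otimes> v) \<otimes> (inv v \<otimes> c)"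
    proof -
      have "(a \<otimes> u) \<otimes> (b' \<otimes> v) \<otimes> (inv v \<otimes> c) = a \<otimes> (u \<otimes> (inv u \<otimes> (b \<otimes> (v \<otimes> (inv v \<otimes> c)))))"
        using carr uG vG by (simp add: b'_def m_assoc)
      also have "\<dots> = a \<otimes> (b \<otimes> c)"
        using carr uG vG by (simp add: m_assoc[symmetric])
      finally show ?thesis
        using w carr by (simp add: m_assoc)
    qed
    ultimately show "w \<in> (S - R) <#> (S - R) <#> (S - R)"
      unfolding set_mult_def by blast
  qed
qed

section \<open>Removing elements without changing the cube\<close>

lemma (in group) card_le_card_cube:
  assumes "finite S" "S \<subseteq> carrier G"
  shows "card S \<le> card (S <#> S <#> S)"
proof (cases "S = {}")
  case False
  then obtain s where s: "s \<in> S" by blast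
  have fin: "finite (S <#> S <#> S)"
    using assms(1) by (simp add: set_mult_def)
  have inj: "inj_on (\<lambda>t. s \<otimes> s \<otimes> t) S"
  proof (rule inj_onI)
    fix t t' assume "t \<in> S" "t' \<in> S" "s \<otimes> s \<otimes> t = s \<otimes> s \<otimes> t'"
    then show "t = t'"
      using s assms(2) by (simp add: subset_iff)
  qed
  have "(\<lambda>t. s \<otimes> s \<otimes> t) ` S \<subseteq> S <#> S <#> S"
    using s unfolding set_mult_def by blast
  then show ?thesis
    using card_inj_on_le[OF inj _ fin] by blast
qed simp

lemma (in group) tripling_exponent_less:
  assumes "finite S" "S \<subseteq> carrier G" "T \<subset> S" "2 \<le> card T"
    and cube: "T <#> T <#> T = S <#> S <#> S"
  shows "tripling_exponent G S < tripling_exponent G T"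
proof -
  have "card T < card S"
    using assms by (simp add: psubset_card_mono)
  then have "1 < card (S <#> S <#> S)"
    using card_le_card_cube[OF assms(1,2)] assms(4) by linarith
  then have "0 < ln (real (card (S <#> S <#> S)))"
    by simp
  moreover have "0 < ln (real (card T))" "ln (real (card T)) < ln (real (card S))"
    using \<open>card T < card S\<close> assms(4) by simp_all
  ultimately show ?thesis
    unfolding tripling_exponent_def cube by (intro divide_strict_left_mono) simp_all
qed

section \<open>The order of the binary octahedral group\<close>

text \<open>The bound comes from the sixteen quaternions \<open>(\<plusminus>1 \<plusminus> i \<plusminus> j \<plusminus> k)/2\<close>. It makes a subgroup of
  index 3 have more than four elements, which is what removing two elements requires in
  \<open>set_mult_cube_Diff\<close>.\<close>

lemma card_binary_octahedral_ge:
  assumes "finite (carrier binary_octahedral)"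
  shows "16 \<le> card (carrier binary_octahedral)"
proof -
  let ?A = "{1/2, -1/2 :: real}"
  let ?f = "\<lambda>(a, b, c, d). Quat a b c d"
  have "inj_on ?f (?A \<times> ?A \<times> ?A \<times> ?A)"
    by (auto intro!: inj_onI)
  moreover have "?f ` (?A \<times> ?A \<times> ?A \<times> ?A) \<subseteq> carrier binary_octahedral"
  proof (rule image_subsetI)
    fix t assume t: "t \<in> ?A \<times> ?A \<times> ?A \<times> ?A"
    obtain a b c d where abcd: "t = (a, b, c, d)"
      by (rule prod_cases4)
    have "{a, b, c, d} \<subseteq> ?A"
      using t unfolding abcd mem_Times_iff fst_conv snd_conv
      by (simp only: insert_subset empty_subsetI simp_thms)
    then have "Quat a b c d \<in> hurwitz_units"
      unfolding hurwitz_units_def by (intro UnI2 CollectI exI conjI) (rule refl)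
    then show "?f t \<in> carrier binary_octahedral"
      by (simp add: abcd binary_octahedral_def)
  qed
  ultimately have "card (?A \<times> ?A \<times> ?A \<times> ?A) \<le> card (carrier binary_octahedral)"
    using assms card_inj_on_le by blast
  then show ?thesis
    by (simp add: card_cartesian_product)
qed

section \<open>Conjugation by an element whose square lies in the subgroup\<close>

lemma (in group) mem_conjugate_iff:
  assumes "H \<subseteq> carrier G" "x \<in> carrier G" "g \<in> carrier G"
  shows "g \<in> inv x <# H #> x \<longleftrightarrow> x \<otimes> g \<otimes> inv x \<in> H"
proof
  assume "g \<in> inv x <# H #> x"
  then obtain h where h: "h \<in> H" and g: "g = inv x \<otimes> h \<otimes> x"
    by (auto simp: l_coset_def r_coset_def)
  have hG: "h \<in> carrier G"
    using h assms by auto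
  have "x \<otimes> g \<otimes> inv x = x \<otimes> (inv x \<otimes> h)"
    using hG assms unfolding g by (simp add: m_assoc)
  also have "\<dots> = h"
    using hG assms by (simp add: m_assoc[symmetric])
  finally show "x \<otimes> g \<otimes> inv x \<in> H"
    using h by simp
next
  assume h: "x \<otimes> g \<otimes> inv x \<in> H"
  have "inv x \<otimes> (x \<otimes> g \<otimes> inv x) \<otimes> x = inv x \<otimes> (x \<otimes> g)"
    using assms by (simp add: m_assoc)
  also have "\<dots> = g"
    using assms by (simp add: m_assoc[symmetric])
  finally show "g \<in> inv x <# H #> x"
    using h unfolding l_coset_def r_coset_def by force
qed

lemma (in group) subgroup_conjugate_Int:
  assumes H: "subgroup H G" and x: "x \<in> carrier G"
  shows "subgroup ((inv x <# H #> x) \<inter> H) G"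
proof -
  have HG: "H \<subseteq> carrier G"
    using H by (rule subgroup.subset)
  note iff = mem_conjugate_iff[OF HG x]
  show ?thesis
  proof (rule subgroupI)
    show "(inv x <# H #> x) \<inter> H \<subseteq> carrier G"
      using HG by blast
    have "\<one> \<in> (inv x <# H #> x) \<inter> H"
      using x subgroup.one_closed[OF H] by (simp add: iff)
    then show "(inv x <# H #> x) \<inter> H \<noteq> {}"
      by blast
  next
    fix a assume "a \<in> (inv x <# H #> x) \<inter> H"
    then have a: "a \<in> H" "a \<in> carrier G" "x \<otimes> a \<otimes> inv x \<in> H"
      using HG iff by auto
    have "inv (x \<otimes> a \<otimes> inv x) = x \<otimes> inv a \<otimes> inv x"
      using a x by (simp add: inv_mult_group m_assoc)
    then have "x \<otimes> inv a \<otimes> inv x \<in> H"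
      using subgroup.m_inv_closed[OF H a(3)] by simp
    then show "inv a \<in> (inv x <# H #> x) \<inter> H"
      using a subgroup.m_inv_closed[OF H] by (simp add: iff)
  next
    fix a b assume "a \<in> (inv x <# H #> x) \<inter> H" "b \<in> (inv x <# H #> x) \<inter> H"
    then have a: "a \<in> H" "a \<in> carrier G" "x \<otimes> a \<otimes> inv x \<in> H"
      and b: "b \<in> H" "b \<in> carrier G" "x \<otimes> b \<otimes> inv x \<in> H"
      using HG iff by auto
    have "(x \<otimes> a \<otimes> inv x) \<otimes> (x \<otimes> b \<otimes> inv x) = x \<otimes> a \<otimes> ((inv x \<otimes> x) \<otimes> b \<otimes> inv x)"
      using a b x by (simp only: m_assoc m_closed inv_closed)
    also have "\<dots> = x \<otimes> (a \<otimes> b) \<otimes> inv x"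
      using a b x by (simp add: m_assoc)
    finally have "x \<otimes> (a \<otimes> b) \<otimes> inv x \<in> H"
      using subgroup.m_closed[OF H a(3) b(3)] by simp
    then show "a \<otimes> b \<in> (inv x <# H #> x) \<inter> H"
      using a b subgroup.m_closed[OF H] by (simp add: iff)
  qed
qed

text \<open>Conjugation by \<open>x\<close> interchanges \<open>H\<close> and \<open>x\<inverse> H x\<close>, since its square is conjugation by
  an element of \<open>H\<close>; so it preserves their intersection.\<close>

lemma (in group) conjugate_Int_normalised:
  assumes H: "subgroup H G" and x: "x \<in> carrier G" and sq: "x \<otimes> x \<in> H"
    and l: "l \<in> (inv x <# H #> x) \<inter> H"
  shows "inv x \<otimes> l \<otimes> x \<in> (inv x <# H #> x) \<inter> H"
proof
  have HG: "H \<subseteq> carrier G"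
    using H by (rule subgroup.subset)
  show "inv x \<otimes> l \<otimes> x \<in> inv x <# H #> x"
    using l by (auto simp: l_coset_def r_coset_def)
  have l': "l \<in> carrier G" "x \<otimes> l \<otimes> inv x \<in> H"
    using l HG mem_conjugate_iff[OF HG x] by auto
  have cancel: "inv x \<otimes> (x \<otimes> g) = g" if "g \<in> carrier G" for g
    using x that by (simp add: m_assoc[symmetric])
  have "inv (x \<otimes> x) \<otimes> (x \<otimes> l \<otimes> inv x) \<otimes> (x \<otimes> x) \<in> H"
    using subgroup.m_closed[OF H] subgroup.m_inv_closed[OF H] sq l' by blast
  moreover have "inv (x \<otimes> x) \<otimes> (x \<otimes> l \<otimes> inv x) \<otimes> (x \<otimes> x) = inv x \<otimes> l \<otimes> x"
    using x l' by (simp add: inv_mult_group m_assoc cancel)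
  ultimately show "inv x \<otimes> l \<otimes> x \<in> H"
    by simp
qed

lemma (in group) subgroup_Un_coset_invariant:
  assumes H: "subgroup H G" and x: "x \<in> carrier G" and sq: "x \<otimes> x \<in> H"
    and L: "L = (inv x <# H #> x) \<inter> H"
  shows "(H \<union> (x <# L)) <#> L \<subseteq> H \<union> (x <# L)"
    and "L <#> (H \<union> (x <# L)) \<subseteq> H \<union> (x <# L)"
proof -
  have sub: "subgroup L G"
    unfolding L using H x by (rule subgroup_conjugate_Int)
  have LG: "L \<subseteq> carrier G" and LH: "L \<subseteq> H"
    using subgroup.subset[OF sub] L by auto
  have right: "x \<otimes> m \<otimes> l \<in> x <# L" if "m \<in> L" "l \<in> L" for m l
  proof -
    have "x \<otimes> m \<otimes> l = x \<otimes> (m \<otimes> l)"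
      using that x LG by (intro m_assoc) auto
    then show ?thesis
      using subgroup.m_closed[OF sub that] by (auto simp: l_coset_def)
  qed
  have left: "l \<otimes> (x \<otimes> m) \<in> x <# L" if "m \<in> L" "l \<in> L" for m l
  proof -
    have G: "m \<in> carrier G" "l \<in> carrier G"
      using that LG by auto
    have n: "inv x \<otimes> l \<otimes> x \<in> L"
      using conjugate_Int_normalised[OF H x sq] that L by blast
    have "l \<otimes> (x \<otimes> m) = (x \<otimes> inv x) \<otimes> (l \<otimes> (x \<otimes> m))"
      using x G by simp
    also have "\<dots> = x \<otimes> (inv x \<otimes> l \<otimes> x) \<otimes> m"
      using x G by (simp only: m_assoc m_closed inv_closed)
    finally show ?thesis
      using right[OF n that(1)] by simp
  qed
  show "(H \<union> (x <# L)) <#> L \<subseteq> H \<union> (x <# L)"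
  proof
    fix w assume "w \<in> (H \<union> (x <# L)) <#> L"
    then obtain s l where "s \<in> H \<union> (x <# L)" "l \<in> L" "w = s \<otimes> l"
      by (auto simp: set_mult_def)
    then show "w \<in> H \<union> (x <# L)"
      using right LH subgroup.m_closed[OF H] by (auto simp: l_coset_def)
  qed
  show "L <#> (H \<union> (x <# L)) \<subseteq> H \<union> (x <# L)"
  proof
    fix w assume "w \<in> L <#> (H \<union> (x <# L))"
    then obtain s l where "s \<in> H \<union> (x <# L)" "l \<in> L" "w = l \<otimes> s"
      by (auto simp: set_mult_def)
    then show "w \<in> H \<union> (x <# L)"
      using left LH subgroup.m_closed[OF H] by (auto simp: l_coset_def)
  qed
qed

section \<open>The tripling exponent increases\<close>

theorem theorem7p2:
  fixes H L S T :: "('p::prime_card mod_ring ^ 2 ^ 2) set"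
    and x z :: "'p mod_ring ^ 2 ^ 2"
  assumes "subgroup H SL2"
    and "SL2\<lparr>carrier := H\<rparr> \<cong> binary_octahedral"
    and "x \<in> carrier SL2"
    and "generate SL2 (insert x H) = carrier SL2"
    and "x [^]\<^bsub>SL2\<^esub> (2::nat) \<in> H"
    and "L = (inv\<^bsub>SL2\<^esub> x <#\<^bsub>SL2\<^esub> H #>\<^bsub>SL2\<^esub> x) \<inter> H"
    and "card (rcosets\<^bsub>SL2\<lparr>carrier := H\<rparr>\<^esub> L) = 3"
    and "S = H \<union> (x <#\<^bsub>SL2\<^esub> L)"
    and "z \<in> S"
    and "T = S - {z, inv\<^bsub>SL2\<^esub> z}"
  shows "tripling_exponent SL2 T > tripling_exponent SL2 S"
proof -
  interpret group "SL2 :: ('p mod_ring ^ 2 ^ 2) monoid"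
    by (rule group_SL2)
  let ?R = "{z, inv\<^bsub>SL2\<^esub> z}"
  have sq: "x \<otimes>\<^bsub>SL2\<^esub> x \<in> H"
    using assms(3,5) by (simp add: numeral_2_eq_2)
  have L: "subgroup L SL2"
    unfolding assms(6) using assms(1,3) by (rule subgroup_conjugate_Int)
  have SG: "S \<subseteq> carrier SL2"
    using subgroup.subset[OF assms(1)] subgroup.subset[OF L] assms(3,8)
    by (auto simp: l_coset_def)
  obtain f where "f \<in> iso (SL2\<lparr>carrier := H\<rparr>) binary_octahedral"
    using assms(2) by (auto simp: is_iso_def)
  then have bij: "bij_betw f H (carrier binary_octahedral)"
    by (simp add: iso_def)
  then have "finite (carrier binary_octahedral)"
    using bij_betw_finite[OF bij] by simp
  then have H: "16 \<le> card H"
    using card_binary_octahedral_ge bij_betw_same_card[OF bij] by simp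
  have "subgroup L (SL2\<lparr>carrier := H\<rparr>)"
    using subgroup_incl[OF L assms(1)] assms(6) by simp
  then have "3 * card L = card H"
    using group.lagrange[OF subgroup_imp_group[OF assms(1)]] assms(7)
    by (fastforce simp: order_def)
  moreover have R: "card ?R \<le> 2"
    by (simp add: card_insert_if)
  ultimately have "2 * card ?R < card L"
    using H by linarith
  then have cube: "T <#>\<^bsub>SL2\<^esub> T <#>\<^bsub>SL2\<^esub> T = S <#>\<^bsub>SL2\<^esub> S <#>\<^bsub>SL2\<^esub> S"
    unfolding assms(10)
    using set_mult_cube_Diff[OF L SG] subgroup_Un_coset_invariant[OF assms(1,3) sq assms(6)] assms(8)
    by simp
  have "card H \<le> card S"
    using assms(8) by (simp add: card_mono)
  then have "2 \<le> card T"
    using H R diff_card_le_card_Diff[of ?R S] unfolding assms(10) by simp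
  moreover have "T \<subset> S"
    using assms(9,10) by blast
  ultimately show ?thesis
    using tripling_exponent_less[OF _ SG _ _ cube] by simp
qed

end
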